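(* Let $\alpha=(\alpha_{ij})$ and $\lambda=(\lambda_{ij})$ be real constant antisymmetric $3\times 3$ matrices with $\theta_\nu := \sum_{\mu=1}^{3}\big(\delta_{\mu\nu}+\tfrac14\lambda_{\mu\nu}\alpha_{\mu\nu}\big)\neq 0$ for $\nu=1,2,3$, and let $q'^i$, $p'_i$, $L'=(L'_1,L'_2,L'_3)$, $H'$, $\{\cdot,\cdot\}_{nc}$ and $F'_{ij}$ be as defined in the context. Suppose that the noncommutative angular momentum vector $L'$ is an integral of motion of $H'$ on $\mathcal{T}^{\ast}\mathcal{Q}$, i.e. $\{H',L'_i\}_{nc}=0$ for $i=1,2,3$ (wherever $H'$ is defined). Then, under the bracket $\{\cdot,\cdot\}_{nc}$, the components $L'_i$ generate the Lie algebra $so(3)$ of the group $SO(3)$, i.e. for all $i,j\in\{1,2,3\}$ $$\{L'_i,L'_j\}_{nc}=\sum_{h=1}^{3}\varepsilon_{ijh}\,F'_{hh}\,L'_h ,$$ where $\varepsilon_{ijh}F'_{hh}$ are the structure constants of the Lie algebra.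
   Context: $\mathcal{Q}=\mathbb{R}^3\setminus\{0\}$ and $\mathcal{T}^{\ast}\mathcal{Q}=\mathcal{Q}\times\mathbb{R}^3$ with coordinates $(q,p)=(q^1,q^2,q^3,p_1,p_2,p_3)$. The real constants $m>0$ (mass) and $k>0$ (coupling) are fixed. Noncommutative coordinates: $q'^i = q^i-\tfrac12\sum_{j=1}^3\alpha_{ij}p_j$ and $p'_i=p_i+\tfrac12\sum_{j=1}^3\lambda_{ij}q^j$, for $i=1,2,3$. Noncommutative Poisson bracket of functions of $(q,p)$: $$\{f,g\}_{nc}=\sum_{\nu=1}^3\theta_\nu^{-1}\left(\frac{\partial f}{\partial p_\nu}\frac{\partial g}{\partial q^\nu}-\frac{\partial f}{\partial q^\nu}\frac{\partial g}{\partial p_\nu}\right).$$ Hamiltonian: $H'=\frac{1}{2m}\sum_{i=1}^3 (p'_i)^2-\frac{k}{Y}$ with $Y=\big(\sum_{i=1}^3 (q'^i)^2\big)^{1/2}$, regarded as a function of $(q,p)$ where $Y\neq0$. Angular momentum: $L'=q'\times p'$, i.e. $L'_1=q'^2p'_3-q'^3p'_2$, $L'_2=q'^3p'_1-q'^1p'_3$, $L'_3=q'^1p'_2-q'^2p'_1$ (superscripts are indices). Constants: $F_{ij}:=\{p'_i,q'^j\}_{nc}$, so that $F_{ii}=\theta_i^{-1}+\tfrac14\sum_{j=1}^3\lambda_{ij}\alpha_{ij}\theta_j^{-1}$ and, for $i\ne j$, $F_{ij}=\tfrac14\sum_{r=1}^3\lambda_{ir}\alpha_{jr}\theta_r^{-1}$;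 and $F'_{ij}:=-F_{ij}$. The symbol $\varepsilon_{ijh}=\tfrac12(i-j)(j-h)(h-i)$ is the Levi-Civita symbol. *)

theory Defs
  imports "HOL-Analysis.Analysis"
begin

text \<open>A point of phase space is a pair \<open>(q, p)\<close>. The matrices of constants \<open>\<alpha>\<close> and \<open>\<Lambda>\<close>
  (the latter with entries \<open>\<lambda>\<^sub>i\<^sub>j\<close>) are explicit parameters throughout.
  In the index type \<open>3\<close> the third index is \<open>3 = 0\<close>.\<close>

type_synonym phase = "(real^3) \<times> (real^3)"

definition config_space :: "(real^3) set" where
  "config_space = UNIV - {0}"

definition cotangent_bundle :: "phase set" where
  "cotangent_bundle = config_space \<times> UNIV"

definition partial_q :: "3 \<Rightarrow> (phase \<Rightarrow> real) \<Rightarrow> phase \<Rightarrow> real" where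
  "partial_q \<nu> f z = deriv (\<lambda>t. f (fst z + t *\<^sub>R axis \<nu> 1, snd z)) 0"

definition partial_p :: "3 \<Rightarrow> (phase \<Rightarrow> real) \<Rightarrow> phase \<Rightarrow> real" where
  "partial_p \<nu> f z = deriv (\<lambda>t. f (fst z, snd z + t *\<^sub>R axis \<nu> 1)) 0"

definition nc_theta :: "real^3^3 \<Rightarrow> real^3^3 \<Rightarrow> 3 \<Rightarrow> real" where
  "nc_theta \<alpha> \<Lambda> \<nu> = (\<Sum>\<mu>\<in>UNIV. of_bool (\<mu> = \<nu>) + (1/4) * \<Lambda> $ \<mu> $ \<nu> * \<alpha> $ \<mu> $ \<nu>)"

definition nc_bracket ::
  "real^3^3 \<Rightarrow> real^3^3 \<Rightarrow> (phase \<Rightarrow> real) \<Rightarrow> (phase \<Rightarrow> real) \<Rightarrow> phase \<Rightarrow> real" where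
  "nc_bracket \<alpha> \<Lambda> f g z =
    (\<Sum>\<nu>\<in>UNIV. inverse (nc_theta \<alpha> \<Lambda> \<nu>) *
       (partial_p \<nu> f z * partial_q \<nu> g z - partial_q \<nu> f z * partial_p \<nu> g z))"

definition nc_q :: "real^3^3 \<Rightarrow> phase \<Rightarrow> real^3" where
  "nc_q \<alpha> z = (\<chi> i. fst z $ i - (1/2) * (\<Sum>j\<in>UNIV. \<alpha> $ i $ j * snd z $ j))"

definition nc_p :: "real^3^3 \<Rightarrow> phase \<Rightarrow> real^3" where
  "nc_p \<Lambda> z = (\<chi> i. snd z $ i + (1/2) * (\<Sum>j\<in>UNIV. \<Lambda> $ i $ j * fst z $ j))"

definition nc_Y :: "real^3^3 \<Rightarrow> phase \<Rightarrow> real" where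
  "nc_Y \<alpha> z = sqrt (\<Sum>i\<in>UNIV. (nc_q \<alpha> z $ i)\<^sup>2)"

text \<open>Meaningful only where \<^term>\<open>nc_Y \<alpha> z \<noteq> 0\<close>; elsewhere the potential term is \<open>k / 0 = 0\<close>.\<close>

definition nc_H :: "real \<Rightarrow> real \<Rightarrow> real^3^3 \<Rightarrow> real^3^3 \<Rightarrow> phase \<Rightarrow> real" where
  "nc_H m k \<alpha> \<Lambda> z = 1 / (2 * m) * (\<Sum>i\<in>UNIV. (nc_p \<Lambda> z $ i)\<^sup>2) - k / nc_Y \<alpha> z"

definition nc_L :: "real^3^3 \<Rightarrow> real^3^3 \<Rightarrow> 3 \<Rightarrow> phase \<Rightarrow> real" where
  "nc_L \<alpha> \<Lambda> i z = cross3 (nc_q \<alpha> z) (nc_p \<Lambda> z) $ i"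

definition nc_F :: "real^3^3 \<Rightarrow> real^3^3 \<Rightarrow> 3 \<Rightarrow> 3 \<Rightarrow> phase \<Rightarrow> real" where
  "nc_F \<alpha> \<Lambda> i j = nc_bracket \<alpha> \<Lambda> (\<lambda>z. nc_p \<Lambda> z $ i) (\<lambda>z. nc_q \<alpha> z $ j)"

definition nc_F' :: "real^3^3 \<Rightarrow> real^3^3 \<Rightarrow> 3 \<Rightarrow> 3 \<Rightarrow> phase \<Rightarrow> real" where
  "nc_F' \<alpha> \<Lambda> i j z = - nc_F \<alpha> \<Lambda> i j z"

definition index_value :: "3 \<Rightarrow> real" where
  "index_value i = (if i = 1 then 1 else if i = 2 then 2 else 3)"

definition levi_civita :: "3 \<Rightarrow> 3 \<Rightarrow> 3 \<Rightarrow> real" where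
  "levi_civita i j h = (1/2) * (index_value i - index_value j) *
     (index_value j - index_value h) * (index_value h - index_value i)"

text \<open>The Lie algebra of \<open>SO(3)\<close>: skew-symmetric matrices with the commutator.\<close>

definition so3 :: "(real^3^3) set" where
  "so3 = {A. transpose A = - A}"

definition commutator :: "real^3^3 \<Rightarrow> real^3^3 \<Rightarrow> real^3^3" where
  "commutator A B = A ** B - B ** A"

inductive_set lie_generated :: "real^3^3 \<Rightarrow> real^3^3 \<Rightarrow> (phase \<Rightarrow> real) set \<Rightarrow> (phase \<Rightarrow> real) set"
  for \<alpha> \<Lambda> :: "real^3^3" and G :: "(phase \<Rightarrow> real) set" where
  gen: "f \<in> G \<Longrightarrow> f \<in> lie_generated \<alpha> \<Lambda> G"
| zero: "(\<lambda>z. 0) \<in> lie_generated \<alpha> \<Lambda> G"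
| add: "f \<in> lie_generated \<alpha> \<Lambda> G \<Longrightarrow> g \<in> lie_generated \<alpha> \<Lambda> G \<Longrightarrow>
    (\<lambda>z. f z + g z) \<in> lie_generated \<alpha> \<Lambda> G"
| scale: "f \<in> lie_generated \<alpha> \<Lambda> G \<Longrightarrow> (\<lambda>z. c * f z) \<in> lie_generated \<alpha> \<Lambda> G"
| bracket: "f \<in> lie_generated \<alpha> \<Lambda> G \<Longrightarrow> g \<in> lie_generated \<alpha> \<Lambda> G \<Longrightarrow>
    nc_bracket \<alpha> \<Lambda> f g \<in> lie_generated \<alpha> \<Lambda> G"

text \<open>\<open>G\<close> generates a copy of \<open>so(3)\<close> under the bracket: some \<open>\<Phi>\<close> is an isomorphism of Lie
  algebras from \<^const>\<open>so3\<close> onto the algebra generated by \<open>G\<close>, where functions are identified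
  when they agree on the open set \<^const>\<open>cotangent_bundle\<close>.\<close>

definition generates_so3 :: "real^3^3 \<Rightarrow> real^3^3 \<Rightarrow> (phase \<Rightarrow> real) set \<Rightarrow> bool" where
  "generates_so3 \<alpha> \<Lambda> G \<longleftrightarrow>
    (\<exists>\<Phi> :: real^3^3 \<Rightarrow> phase \<Rightarrow> real.
      (\<forall>A\<in>so3. \<Phi> A \<in> lie_generated \<alpha> \<Lambda> G) \<and>
      (\<forall>f\<in>lie_generated \<alpha> \<Lambda> G. \<exists>A\<in>so3. \<forall>z\<in>cotangent_bundle. f z = \<Phi> A z) \<and>
      (\<forall>A\<in>so3. \<forall>B\<in>so3. (\<forall>z\<in>cotangent_bundle. \<Phi> A z = \<Phi> B z) \<longrightarrow> A = B) \<and>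
      (\<forall>A\<in>so3. \<forall>B\<in>so3. \<forall>z\<in>cotangent_bundle. \<Phi> (A + B) z = \<Phi> A z + \<Phi> B z) \<and>
      (\<forall>c. \<forall>A\<in>so3. \<forall>z\<in>cotangent_bundle. \<Phi> (c *\<^sub>R A) z = c * \<Phi> A z) \<and>
      (\<forall>A\<in>so3. \<forall>B\<in>so3. \<forall>z\<in>cotangent_bundle.
         \<Phi> (commutator A B) z = nc_bracket \<alpha> \<Lambda> (\<Phi> A) (\<Phi> B) z))"

lemma axis_nth_of_bool: "axis \<nu> 1 $ j = (of_bool (j = \<nu>) :: real)"
  by (simp add: axis_def)

lemma partial_nc_q [simp]:
  "partial_q \<nu> (\<lambda>z. nc_q \<alpha> z $ i) z = of_bool (i = \<nu>)"
  "partial_p \<nu> (\<lambda>z. nc_q \<alpha> z $ i) z = - (1/2) * \<alpha> $ i $ \<nu>"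
proof -
  show "partial_q \<nu> (\<lambda>z. nc_q \<alpha> z $ i) z = of_bool (i = \<nu>)"
    unfolding partial_q_def nc_q_def
    by (rule DERIV_imp_deriv) (auto intro!: derivative_eq_intros simp: axis_nth_of_bool)
  show "partial_p \<nu> (\<lambda>z. nc_q \<alpha> z $ i) z = - (1/2) * \<alpha> $ i $ \<nu>"
    unfolding partial_p_def nc_q_def vec_lambda_beta fst_conv snd_conv vector_add_component
      vector_scaleR_component axis_nth_of_bool real_scaleR_def
    by (rule DERIV_imp_deriv) ((rule derivative_eq_intros refl)+, simp)
qed

lemma partial_nc_p [simp]:
  "partial_q \<nu> (\<lambda>z. nc_p \<Lambda> z $ i) z = (1/2) * \<Lambda> $ i $ \<nu>"
  "partial_p \<nu> (\<lambda>z. nc_p \<Lambda> z $ i) z = of_bool (i = \<nu>)"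
proof -
  show "partial_q \<nu> (\<lambda>z. nc_p \<Lambda> z $ i) z = (1/2) * \<Lambda> $ i $ \<nu>"
    unfolding partial_q_def nc_p_def vec_lambda_beta fst_conv snd_conv vector_add_component
      vector_scaleR_component axis_nth_of_bool real_scaleR_def
    by (rule DERIV_imp_deriv) ((rule derivative_eq_intros refl)+, simp)
  show "partial_p \<nu> (\<lambda>z. nc_p \<Lambda> z $ i) z = of_bool (i = \<nu>)"
    unfolding partial_p_def nc_p_def
    by (rule DERIV_imp_deriv) (auto intro!: derivative_eq_intros simp: axis_nth_of_bool)
qed

text \<open>In particular \<^const>\<open>nc_F\<close> does not depend on the phase space point.\<close>

lemma nc_F_eq:
  "nc_F \<alpha> \<Lambda> i j z = of_bool (i = j) * inverse (nc_theta \<alpha> \<Lambda> i) +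
     (1/4) * (\<Sum>r\<in>UNIV. \<Lambda> $ i $ r * \<alpha> $ j $ r * inverse (nc_theta \<alpha> \<Lambda> r))"
proof -
  have "nc_F \<alpha> \<Lambda> i j z = (\<Sum>\<nu>\<in>UNIV. of_bool (i = \<nu>) * (of_bool (i = j) * inverse (nc_theta \<alpha> \<Lambda> i))
      + (1/4) * (\<Lambda> $ i $ \<nu> * \<alpha> $ j $ \<nu> * inverse (nc_theta \<alpha> \<Lambda> \<nu>)))"
    unfolding nc_F_def nc_bracket_def by (rule sum.cong) (auto simp: algebra_simps)
  then show ?thesis
    by (simp add: sum.distrib sum_distrib_left flip: sum_distrib_right)
qed

end

theory Submission imports Defs begin

text \<open>Writing \<open>u = q'\<close> and \<open>v = p'\<close>, the bracket \<open>{H', L'}\<close> is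
  \<open>K(u, v) / m + k P(u, v) / |u|\<^sup>3\<close> with quadratic maps \<open>K\<close> and \<open>P\<close>, so comparing the points
  \<open>z\<close> and \<open>2 z\<close> shows that both terms vanish separately. Let \<open>a\<close> be the axial vector of \<open>\<alpha>\<close>.
  Adding \<open>(0, a)\<close> to \<open>(q, 0)\<close> moves \<open>v\<close> but not \<open>u\<close>, because \<open>\<alpha> a = 0\<close>; hence \<open>P = 0\<close> forces
  \<open>{q'\<^sup>i, q'\<^sup>j} = 0\<close>, i.e. \<open>\<alpha>\<^sub>i\<^sub>j = 0\<close> or \<open>\<theta>\<^sub>i\<close> and \<open>\<theta>\<^sub>j\<close> are opposite, and then that \<open>F\<close> is diagonal.
  If \<open>\<alpha>\<^sub>i\<^sub>j \<noteq> 0\<close>, a diagonal \<open>F\<close> gives \<open>\<theta>\<^sub>i = \<theta>\<^sub>j\<close>, a contradiction. So \<open>\<alpha> = 0\<close>, and \<open>K = 0\<close> then yields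
  \<open>\<Lambda> = 0\<close>: the hypothesis leaves only the canonical bracket and the usual angular momentum.\<close>

section \<open>The bracket of H' and L' as a kinetic plus a potential part\<close>

lemma skew_nth:
  fixes A :: "real^'n^'n"
  assumes "transpose A = - A"
  shows "A $ i $ j = - A $ j $ i"
  using arg_cong[OF assms, of "\<lambda>B. B $ j $ i"] by (simp add: transpose_def)

text \<open>Both maps are linear in \<open>z\<close>, so coordinate lines become straight lines in
  \<open>u = q'\<close> and \<open>v = p'\<close>. The partial derivatives of H' and L' are thus
  one-variable derivatives along such lines.\<close>

lemma nc_q_shift:
  "nc_q \<alpha> (fst z + t *\<^sub>R axis \<nu> 1, snd z) = nc_q \<alpha> z + t *\<^sub>R axis \<nu> 1"
  "nc_q \<alpha> (fst z, snd z + t *\<^sub>R axis \<nu> 1) = nc_q \<alpha> z + t *\<^sub>R (- (1/2) *\<^sub>R column \<nu> \<alpha>)"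
  by (simp_all add: nc_q_def vec_eq_iff column_def distrib_left sum.distrib
      mult.left_commute[of _ t] axis_nth_of_bool flip: sum_distrib_left)

lemma nc_p_shift:
  "nc_p \<Lambda> (fst z + t *\<^sub>R axis \<nu> 1, snd z) = nc_p \<Lambda> z + t *\<^sub>R ((1/2) *\<^sub>R column \<nu> \<Lambda>)"
  "nc_p \<Lambda> (fst z, snd z + t *\<^sub>R axis \<nu> 1) = nc_p \<Lambda> z + t *\<^sub>R axis \<nu> 1"
  by (simp_all add: nc_p_def vec_eq_iff column_def distrib_left sum.distrib
      mult.left_commute[of _ t] axis_nth_of_bool flip: sum_distrib_left)

lemma nc_Y_eq_norm: "nc_Y \<alpha> z = norm (nc_q \<alpha> z)"
  by (simp add: nc_Y_def norm_vec_def L2_set_def)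

lemma deriv_kepler:
  fixes u v a b :: "real^3"
  assumes "u \<noteq> 0"
  shows "deriv (\<lambda>t. 1 / (2 * m) * (\<Sum>i\<in>UNIV. ((v + t *\<^sub>R b) $ i)\<^sup>2) - k / norm (u + t *\<^sub>R a)) 0
    = (v \<bullet> b) / m + k / norm u ^ 3 * (u \<bullet> a)"
proof (rule DERIV_imp_deriv)
  have n: "norm u \<noteq> 0"
    using assms by simp
  have "((\<lambda>t. sqrt ((u + t *\<^sub>R a) \<bullet> (u + t *\<^sub>R a))) has_real_derivative (u \<bullet> a) / norm u) (at 0)"
  proof -
    \<comment> \<open>The squared norm is a quadratic polynomial in \<open>t\<close>, positive at
      \<open>t = 0\<close> because \<open>u\<close> is nonzero, so the chain rule for
      \<open>sqrt\<close> applies.\<close>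
    have "((\<lambda>t. u \<bullet> u + 2 * (u \<bullet> a) * t + (a \<bullet> a) * t\<^sup>2) has_real_derivative 2 * (u \<bullet> a)) (at 0)"
      by (auto intro!: derivative_eq_intros)
    then have "((\<lambda>t. (u + t *\<^sub>R a) \<bullet> (u + t *\<^sub>R a)) has_real_derivative 2 * (u \<bullet> a)) (at 0)"
      by (simp add: inner_add inner_commute algebra_simps power2_eq_square)
    from DERIV_chain2[OF DERIV_real_sqrt this] show ?thesis
      using assms by (simp add: norm_eq_sqrt_inner field_simps)
  qed
  then have "((\<lambda>t. norm (u + t *\<^sub>R a)) has_real_derivative (u \<bullet> a) / norm u) (at 0)"
    by (simp add: norm_eq_sqrt_inner)
  note norm' = this
  have "((\<lambda>t. 1 / (2 * m) * (\<Sum>i\<in>UNIV. ((v + t *\<^sub>R b) $ i)\<^sup>2)) has_real_derivative (v \<bullet> b) / m) (at 0)"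
  proof -
    have "((\<lambda>t. \<Sum>i\<in>UNIV. ((v + t *\<^sub>R b) $ i)\<^sup>2) has_real_derivative 2 * (v \<bullet> b)) (at 0)"
      unfolding sum_3 inner_vec_def
      by (auto intro!: derivative_eq_intros)
    from DERIV_cmult[OF this, of "1 / (2 * m)"] show ?thesis
      by simp
  qed
  moreover have "((\<lambda>t. k / norm (u + t *\<^sub>R a)) has_real_derivative - (k / norm u ^ 3 * (u \<bullet> a))) (at 0)"
    using n by (auto intro!: derivative_eq_intros norm' simp: field_simps power3_eq_cube)
  ultimately show "((\<lambda>t. 1 / (2 * m) * (\<Sum>i\<in>UNIV. ((v + t *\<^sub>R b) $ i)\<^sup>2) - k / norm (u + t *\<^sub>R a))
      has_real_derivative (v \<bullet> b) / m + k / norm u ^ 3 * (u \<bullet> a)) (at 0)"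
    using DERIV_diff by fastforce
qed

lemma deriv_cross3:
  "deriv (\<lambda>t. cross3 (u + t *\<^sub>R a) (v + t *\<^sub>R b) $ i) 0 = (cross3 a v + cross3 u b) $ i"
  using exhaust_3[of i]
  by (intro DERIV_imp_deriv) (auto intro!: derivative_eq_intros simp: cross3_def)

text \<open>For skew-symmetric \<open>\<alpha>\<close> and \<open>\<Lambda>\<close>, \<open>nc_matrix \<alpha> \<Lambda> \<alpha>\<close> has the entries \<open>- {q'\<^sup>i, q'\<^sup>j}\<close> and
  \<open>nc_matrix \<alpha> \<Lambda> \<Lambda>\<close> the entries \<open>- {p'\<^sub>i, p'\<^sub>j}\<close>.\<close>

definition nc_matrix :: "real^3^3 \<Rightarrow> real^3^3 \<Rightarrow> real^3^3 \<Rightarrow> real^3^3" where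
  "nc_matrix \<alpha> \<Lambda> A = (\<chi> i j.
     1/2 * (inverse (nc_theta \<alpha> \<Lambda> j) * A $ i $ j - inverse (nc_theta \<alpha> \<Lambda> i) * A $ j $ i))"

definition F_matrix :: "real^3^3 \<Rightarrow> real^3^3 \<Rightarrow> real^3^3" where
  "F_matrix \<alpha> \<Lambda> = (\<chi> i j. of_bool (i = j) * inverse (nc_theta \<alpha> \<Lambda> i) +
     (1/4) * (\<Sum>r\<in>UNIV. \<Lambda> $ i $ r * \<alpha> $ j $ r * inverse (nc_theta \<alpha> \<Lambda> r)))"

text \<open>By the Leibniz rule this is {|p'|^2 / 2, q' x p'}, and \<open>potential_part\<close> is
  {|q'|^2 / 2, q' x p'}. The factor k / |u|^3 arises because it multiplies the gradient of |u|^2 / 2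
  in that of -k / |u|.\<close>

definition kinetic_part :: "real^3^3 \<Rightarrow> real^3^3 \<Rightarrow> real^3 \<Rightarrow> real^3 \<Rightarrow> real^3" where
  "kinetic_part \<alpha> \<Lambda> u v = cross3 (v v* F_matrix \<alpha> \<Lambda>) v + cross3 u (nc_matrix \<alpha> \<Lambda> \<Lambda> *v v)"

definition potential_part :: "real^3^3 \<Rightarrow> real^3^3 \<Rightarrow> real^3 \<Rightarrow> real^3 \<Rightarrow> real^3" where
  "potential_part \<alpha> \<Lambda> u v = cross3 (nc_matrix \<alpha> \<Lambda> \<alpha> *v u) v - cross3 u (F_matrix \<alpha> \<Lambda> *v u)"

text \<open>Regrouped by canonical pair, the cross products become the summands of
  \<open>nc_bracket\<close> with the derivatives of L' inserted; \<open>potential_part_sum\<close>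
  does the same for the other part.\<close>

lemma kinetic_part_sum:
  "kinetic_part \<alpha> \<Lambda> u v = (\<Sum>\<nu>\<in>UNIV. inverse (nc_theta \<alpha> \<Lambda> \<nu>) *\<^sub>R
     (v $ \<nu> *\<^sub>R (cross3 (axis \<nu> 1) v + (1/2) *\<^sub>R cross3 u (column \<nu> \<Lambda>))
      - (1/2 * (v \<bullet> column \<nu> \<Lambda>)) *\<^sub>R (cross3 u (axis \<nu> 1) - (1/2) *\<^sub>R cross3 (column \<nu> \<alpha>) v)))"
proof -
  have F: "v v* F_matrix \<alpha> \<Lambda> = (\<Sum>\<nu>\<in>UNIV. inverse (nc_theta \<alpha> \<Lambda> \<nu>) *\<^sub>R
      (v $ \<nu> *\<^sub>R axis \<nu> 1 + (1/4 * (v \<bullet> column \<nu> \<Lambda>)) *\<^sub>R column \<nu> \<alpha>))"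
    unfolding vec_eq_iff forall_3
    by (simp add: F_matrix_def vector_matrix_mult_def sum_3 column_def inner_vec_def axis_def algebra_simps)
  have A: "nc_matrix \<alpha> \<Lambda> \<Lambda> *v v = (\<Sum>\<nu>\<in>UNIV. inverse (nc_theta \<alpha> \<Lambda> \<nu>) *\<^sub>R
      ((1/2 * v $ \<nu>) *\<^sub>R column \<nu> \<Lambda> - (1/2 * (v \<bullet> column \<nu> \<Lambda>)) *\<^sub>R axis \<nu> 1))"
    unfolding vec_eq_iff forall_3
    by (simp add: nc_matrix_def matrix_vector_mult_def sum_3 column_def inner_vec_def axis_def algebra_simps)
  show ?thesis
    by (simp add: kinetic_part_def F A Cross3.left_diff_distrib Cross3.right_diff_distrib sum_3 cross_add_left cross_add_right cross_mult_left
        cross_mult_right algebra_simps)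
qed

lemma potential_part_sum:
  "potential_part \<alpha> \<Lambda> u v = (\<Sum>\<nu>\<in>UNIV. inverse (nc_theta \<alpha> \<Lambda> \<nu>) *\<^sub>R
     (- (1/2 * (u \<bullet> column \<nu> \<alpha>)) *\<^sub>R (cross3 (axis \<nu> 1) v + (1/2) *\<^sub>R cross3 u (column \<nu> \<Lambda>))
      - u $ \<nu> *\<^sub>R (cross3 u (axis \<nu> 1) - (1/2) *\<^sub>R cross3 (column \<nu> \<alpha>) v)))"
proof -
  have F: "F_matrix \<alpha> \<Lambda> *v u = (\<Sum>\<nu>\<in>UNIV. inverse (nc_theta \<alpha> \<Lambda> \<nu>) *\<^sub>R
      (u $ \<nu> *\<^sub>R axis \<nu> 1 + (1/4 * (u \<bullet> column \<nu> \<alpha>)) *\<^sub>R column \<nu> \<Lambda>))"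
    unfolding vec_eq_iff forall_3
    by (simp add: F_matrix_def matrix_vector_mult_def sum_3 column_def inner_vec_def axis_def algebra_simps)
  have A: "nc_matrix \<alpha> \<Lambda> \<alpha> *v u = (\<Sum>\<nu>\<in>UNIV. inverse (nc_theta \<alpha> \<Lambda> \<nu>) *\<^sub>R
      ((1/2 * u $ \<nu>) *\<^sub>R column \<nu> \<alpha> - (1/2 * (u \<bullet> column \<nu> \<alpha>)) *\<^sub>R axis \<nu> 1))"
    unfolding vec_eq_iff forall_3
    by (simp add: nc_matrix_def matrix_vector_mult_def sum_3 column_def inner_vec_def axis_def algebra_simps)
  show ?thesis
    by (simp add: potential_part_def F A Cross3.left_diff_distrib Cross3.right_diff_distrib sum_3 cross_add_left cross_add_right cross_mult_left
        cross_mult_right algebra_simps)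
qed

lemma partial_nc_L:
  "partial_q \<nu> (nc_L \<alpha> \<Lambda> i) z =
     (cross3 (axis \<nu> 1) (nc_p \<Lambda> z) + (1/2) *\<^sub>R cross3 (nc_q \<alpha> z) (column \<nu> \<Lambda>)) $ i"
  "partial_p \<nu> (nc_L \<alpha> \<Lambda> i) z =
     (cross3 (nc_q \<alpha> z) (axis \<nu> 1) - (1/2) *\<^sub>R cross3 (column \<nu> \<alpha>) (nc_p \<Lambda> z)) $ i"
  unfolding partial_q_def partial_p_def nc_L_def nc_q_shift nc_p_shift deriv_cross3
  by (simp_all add: cross_mult_left cross_mult_right cross_minus_left)

lemma partial_nc_H:
  assumes "nc_q \<alpha> z \<noteq> 0"
  shows "partial_q \<nu> (nc_H m k \<alpha> \<Lambda>) z =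
      1 / m * (1/2 * (nc_p \<Lambda> z \<bullet> column \<nu> \<Lambda>)) + k / norm (nc_q \<alpha> z) ^ 3 * nc_q \<alpha> z $ \<nu>"
    and "partial_p \<nu> (nc_H m k \<alpha> \<Lambda>) z =
      1 / m * nc_p \<Lambda> z $ \<nu> - k / norm (nc_q \<alpha> z) ^ 3 * (1/2 * (nc_q \<alpha> z \<bullet> column \<nu> \<alpha>))"
  unfolding partial_q_def partial_p_def nc_H_def nc_q_shift nc_p_shift nc_Y_eq_norm
    deriv_kepler[OF assms]
  by (simp_all add: inner_axis)

lemma nc_bracket_H_L:
  assumes "nc_q \<alpha> z \<noteq> 0"
  shows "nc_bracket \<alpha> \<Lambda> (nc_H m k \<alpha> \<Lambda>) (nc_L \<alpha> \<Lambda> i) z =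
    ((1 / m) *\<^sub>R kinetic_part \<alpha> \<Lambda> (nc_q \<alpha> z) (nc_p \<Lambda> z) +
     (k / norm (nc_q \<alpha> z) ^ 3) *\<^sub>R potential_part \<alpha> \<Lambda> (nc_q \<alpha> z) (nc_p \<Lambda> z)) $ i"
  unfolding nc_bracket_def partial_nc_L partial_nc_H[OF assms] kinetic_part_sum potential_part_sum
  by (simp add: sum_3 algebra_simps)

lemma nc_scaleR:
  "nc_q \<alpha> (c *\<^sub>R z) = c *\<^sub>R nc_q \<alpha> z" "nc_p \<Lambda> (c *\<^sub>R z) = c *\<^sub>R nc_p \<Lambda> z"
  by (simp_all add: nc_q_def nc_p_def vec_eq_iff algebra_simps sum_distrib_left)

lemma part_scaleR:
  "kinetic_part \<alpha> \<Lambda> (c *\<^sub>R u) (c *\<^sub>R v) = c\<^sup>2 *\<^sub>R kinetic_part \<alpha> \<Lambda> u v"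
  "potential_part \<alpha> \<Lambda> (c *\<^sub>R u) (c *\<^sub>R v) = c\<^sup>2 *\<^sub>R potential_part \<alpha> \<Lambda> u v"
  by (simp_all add: kinetic_part_def potential_part_def cross_mult_left cross_mult_right
      matrix_vector_mult_scaleR vector_matrix_mul_rid scaleR_vector_matrix_assoc
      algebra_simps power2_eq_square)

lemma parts_eq_0:
  assumes "m > 0" "k > 0"
    and H: "\<And>i z. z \<in> cotangent_bundle \<Longrightarrow> nc_Y \<alpha> z \<noteq> 0 \<Longrightarrow>
           nc_bracket \<alpha> \<Lambda> (nc_H m k \<alpha> \<Lambda>) (nc_L \<alpha> \<Lambda> i) z = 0"
    and z: "fst z \<noteq> 0" "nc_q \<alpha> z \<noteq> 0"
  shows "kinetic_part \<alpha> \<Lambda> (nc_q \<alpha> z) (nc_p \<Lambda> z) = 0"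
    and "potential_part \<alpha> \<Lambda> (nc_q \<alpha> z) (nc_p \<Lambda> z) = 0"
proof -
  define K P n where "K = kinetic_part \<alpha> \<Lambda> (nc_q \<alpha> z) (nc_p \<Lambda> z)"
    and "P = potential_part \<alpha> \<Lambda> (nc_q \<alpha> z) (nc_p \<Lambda> z)" and "n = norm (nc_q \<alpha> z)"
  \<comment> \<open>Along the ray through \<open>z\<close>, K has degree 2 and P / |u|^3 has degree
    -1.\<close>
  have eq: "c\<^sup>2 *\<^sub>R (1 / m) *\<^sub>R K + (1 / c) *\<^sub>R (k / n ^ 3) *\<^sub>R P = 0" if "c > 0" for c :: real
  proof -
    have c: "c *\<^sub>R z \<in> cotangent_bundle" "nc_q \<alpha> (c *\<^sub>R z) \<noteq> 0"
      using z that by (auto simp: cotangent_bundle_def config_space_def nc_scaleR mem_Times_iff)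
    have "((1 / m) *\<^sub>R c\<^sup>2 *\<^sub>R K + (k / (c * n) ^ 3) *\<^sub>R c\<^sup>2 *\<^sub>R P) $ i = 0" for i
      using H[OF c(1), of i] c(2) that
      unfolding nc_bracket_H_L[OF c(2)] nc_Y_eq_norm norm_eq_zero
      by (simp add: nc_scaleR part_scaleR K_def P_def n_def)
    then have "(1 / m) *\<^sub>R c\<^sup>2 *\<^sub>R K + (k / (c * n) ^ 3) *\<^sub>R c\<^sup>2 *\<^sub>R P = 0"
      by (simp add: vec_eq_iff)
    then show ?thesis
      using that by (simp add: power2_eq_square power3_eq_cube mult_ac)
  qed
  \<comment> \<open>The equation for \<open>c = 2\<close> minus half of the one for
    \<open>c = 1\<close> cancels P and leaves 4 - 1/2 = 7/2.\<close>
  have "(7 / 2) *\<^sub>R (1 / m) *\<^sub>R K = (2\<^sup>2 *\<^sub>R (1 / m) *\<^sub>R K + (1 / 2) *\<^sub>R (k / n ^ 3) *\<^sub>R P)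
      - (1 / 2) *\<^sub>R (1\<^sup>2 *\<^sub>R (1 / m) *\<^sub>R K + (1 / 1) *\<^sub>R (k / n ^ 3) *\<^sub>R P)"
    unfolding vec_eq_iff by (simp add: algebra_simps)
  then have "(7 / 2) *\<^sub>R (1 / m) *\<^sub>R K = 0"
    using eq[of 1] eq[of 2] by (simp only:) simp
  then have K: "K = 0"
    using \<open>m > 0\<close> by simp
  then show "kinetic_part \<alpha> \<Lambda> (nc_q \<alpha> z) (nc_p \<Lambda> z) = 0"
    by (simp add: K_def)
  show "potential_part \<alpha> \<Lambda> (nc_q \<alpha> z) (nc_p \<Lambda> z) = 0"
    using eq[of 1] K z \<open>k > 0\<close> by (simp add: n_def flip: P_def)
qed

lemma noncommutativity_eq_0:
  assumes skew: "transpose \<alpha> = - \<alpha>" "transpose \<Lambda> = - \<Lambda>"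
    and \<theta>: "\<And>\<nu>. nc_theta \<alpha> \<Lambda> \<nu> \<noteq> 0"
    and K: "\<And>z. fst z \<noteq> 0 \<Longrightarrow> nc_q \<alpha> z \<noteq> 0 \<Longrightarrow> kinetic_part \<alpha> \<Lambda> (nc_q \<alpha> z) (nc_p \<Lambda> z) = 0"
    and P: "\<And>z. fst z \<noteq> 0 \<Longrightarrow> nc_q \<alpha> z \<noteq> 0 \<Longrightarrow> potential_part \<alpha> \<Lambda> (nc_q \<alpha> z) (nc_p \<Lambda> z) = 0"
  shows "\<alpha> = 0" "\<Lambda> = 0"
proof -
  have diag: "\<alpha> $ i $ i = 0"  "\<Lambda> $ i $ i = 0" for i
    using skew_nth[OF skew(1), of i i] skew_nth[OF skew(2), of i i] by auto
  note sk = skew_nth[OF skew(1), of 2 1] skew_nth[OF skew(1), of 3 1] skew_nth[OF skew(1), of 3 2]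
    skew_nth[OF skew(2), of 2 1] skew_nth[OF skew(2), of 3 1] skew_nth[OF skew(2), of 3 2] diag
  define w where "w = (\<lambda>\<nu>. inverse (nc_theta \<alpha> \<Lambda> \<nu>))"
  have w: "w \<nu> \<noteq> 0" for \<nu>
    using \<theta> by (simp add: w_def)
  have A: "nc_matrix \<alpha> \<Lambda> \<alpha> $ i $ j = 1/2 * ((w i + w j) * \<alpha> $ i $ j)"
    "nc_matrix \<alpha> \<Lambda> \<Lambda> $ i $ j = 1/2 * ((w i + w j) * \<Lambda> $ i $ j)" for i j
    using skew_nth[OF skew(1), of j i] skew_nth[OF skew(2), of j i]
    by (simp_all add: nc_matrix_def w_def algebra_simps)
  \<comment> \<open>With these signs \<open>\<alpha> *v x = cross3 x a\<close>, so
    \<open>\<alpha> *v a = 0\<close>.\<close>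
  define a :: "real^3" where "a = vector [\<alpha>$2$3, - \<alpha>$1$3, \<alpha>$1$2]"
  have q: "nc_q \<alpha> (axis i 1, t *\<^sub>R a) = axis i 1" for i t
    unfolding nc_q_def vec_eq_iff forall_3
    by (simp add: sum_3 a_def sk)
  have p: "nc_p \<Lambda> (axis i 1, t *\<^sub>R a) = t *\<^sub>R a + (1/2) *\<^sub>R column i \<Lambda>" for i t
    unfolding nc_p_def vec_eq_iff by (simp add: column_def axis_nth_of_bool)
  have P': "potential_part \<alpha> \<Lambda> (axis i 1) (t *\<^sub>R a + (1/2) *\<^sub>R column i \<Lambda>) = 0" for i t
    using P[of "(axis i 1, t *\<^sub>R a)"] unfolding q p by (simp add: axis_eq_0_iff)
  \<comment> \<open>P is affine in \<open>v\<close>, so the difference between \<open>t = 1\<close>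
    and \<open>t = 0\<close> isolates its linear part at \<open>a\<close>.\<close>
  have Aa: "cross3 (column i (nc_matrix \<alpha> \<Lambda> \<alpha>)) a = 0" for i
    using P'[of i 0] P'[of i 1]
    by (simp add: potential_part_def cross_add_right matrix_vector_mul_component matrix_vector_mult_basis)
  \<comment> \<open>Three numbers whose pairwise sums vanish are all zero.\<close>
  have "(w 1 + w 2) * (\<alpha>$1$2)\<^sup>2 + (w 1 + w 3) * (\<alpha>$1$3)\<^sup>2 = 0"
    "(w 1 + w 2) * (\<alpha>$1$2)\<^sup>2 + (w 2 + w 3) * (\<alpha>$2$3)\<^sup>2 = 0"
    "(w 1 + w 3) * (\<alpha>$1$3)\<^sup>2 + (w 2 + w 3) * (\<alpha>$2$3)\<^sup>2 = 0"
    using Aa[of 1] Aa[of 2] Aa[of 3]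
    by (simp_all add: vec_eq_iff forall_3 cross3_def column_def A a_def sk power2_eq_square algebra_simps)
  then have Az: "\<alpha>$1$2 = 0 \<or> w 1 + w 2 = 0" "\<alpha>$1$3 = 0 \<or> w 1 + w 3 = 0" "\<alpha>$2$3 = 0 \<or> w 2 + w 3 = 0"
    by (smt (verit) mult_eq_0_iff power_eq_0_iff)+
  have "nc_matrix \<alpha> \<Lambda> \<alpha> = 0"
    unfolding vec_eq_iff forall_3 using Az by (auto simp: A sk)
  then have "cross3 (axis i 1) (F_matrix \<alpha> \<Lambda> *v axis i 1) = 0" for i
    using P'[of i 0] by (simp add: potential_part_def)
  then have "cross3 (axis i 1) (column i (F_matrix \<alpha> \<Lambda>)) = 0" for i
    by (simp add: matrix_vector_mult_basis)
  from this[of 1] this[of 2] this[of 3]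
  \<comment> \<open>The off-diagonal entries of F vanish. By skewness only the third index
    contributes to the sum in such an entry, and its weight is nonzero.\<close>
  have Fz: "\<Lambda>$2$3 * \<alpha>$1$3 = 0" "\<Lambda>$2$3 * \<alpha>$1$2 = 0" "\<Lambda>$1$3 * \<alpha>$2$3 = 0" "\<Lambda>$1$3 * \<alpha>$1$2 = 0"
    "\<Lambda>$1$2 * \<alpha>$2$3 = 0" "\<Lambda>$1$2 * \<alpha>$1$3 = 0"
    using \<theta> by (simp_all add: vec_eq_iff forall_3 cross3_def column_def F_matrix_def sum_3 sk axis_def)
  have th: "nc_theta \<alpha> \<Lambda> 1 = 1 + (\<Lambda>$1$2 * \<alpha>$1$2 + \<Lambda>$1$3 * \<alpha>$1$3) / 4"
    "nc_theta \<alpha> \<Lambda> 2 = 1 + (\<Lambda>$1$2 * \<alpha>$1$2 + \<Lambda>$2$3 * \<alpha>$2$3) / 4"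
    "nc_theta \<alpha> \<Lambda> 3 = 1 + (\<Lambda>$1$3 * \<alpha>$1$3 + \<Lambda>$2$3 * \<alpha>$2$3) / 4"
    by (simp_all add: nc_theta_def sum_3 sk)
  \<comment> \<open>If this entry is nonzero, \<open>Fz\<close> kills the other two entries of
    \<open>\<Lambda>\<close>, so \<open>th\<close> gives both thetas the same value;
    \<open>Az\<close> makes their inverses opposite. The next two cases are alike.\<close>
  have "\<alpha>$1$2 = 0"
  proof (rule ccontr)
    assume "\<alpha>$1$2 \<noteq> 0"
    then have "w 1 = w 2" "w 1 + w 2 = 0"
      using Fz Az by (simp_all add: w_def th)
    then show False using w[of 1] by simp
  qed
  moreover have "\<alpha>$1$3 = 0"
  proof (rule ccontr)
    assume "\<alpha>$1$3 \<noteq> 0"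
    then have "w 1 = w 3" "w 1 + w 3 = 0"
      using Fz Az by (simp_all add: w_def th)
    then show False using w[of 1] by simp
  qed
  moreover have "\<alpha>$2$3 = 0"
  proof (rule ccontr)
    assume "\<alpha>$2$3 \<noteq> 0"
    then have "w 2 = w 3" "w 2 + w 3 = 0"
      using Fz Az by (simp_all add: w_def th)
    then show False using w[of 2] by simp
  qed
  ultimately show \<alpha>: "\<alpha> = 0"
    unfolding vec_eq_iff forall_3 by (simp add: sk)
  have w1: "w \<nu> = 1" for \<nu>
    by (simp add: w_def \<alpha> nc_theta_def)
  have F: "F_matrix \<alpha> \<Lambda> = mat 1"
    by (simp add: F_matrix_def nc_theta_def \<alpha> mat_def vec_eq_iff)
  have "cross3 (axis i 1) (column j \<Lambda>) = 0" for i j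
  proof -
    \<comment> \<open>Now q' = q and K(u, v) is the cross product of \<open>u\<close> with
      \<open>\<Lambda> *v v\<close>. The shift in the momentum makes p' equal to the basis vector
      \<open>axis j 1\<close>.\<close>
    define z :: phase where "z = (axis i 1, axis j 1 - (1/2) *\<^sub>R column i \<Lambda>)"
    have "nc_q \<alpha> z = axis i 1" "nc_p \<Lambda> z = axis j 1"
      by (simp_all add: z_def nc_q_def nc_p_def \<alpha> vec_eq_iff column_def axis_nth_of_bool)
    moreover have "nc_matrix \<alpha> \<Lambda> \<Lambda> = \<Lambda>"
      by (simp add: vec_eq_iff A w1)
    ultimately show ?thesis
      using K[of z] by (simp add: z_def kinetic_part_def F axis_eq_0_iff cross_refl matrix_vector_mult_basis)
  qed
  \<comment> \<open>A column parallel to two different basis vectors is zero.\<close>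
  from this[of 1 1] this[of 1 2] this[of 1 3] this[of 2 1] this[of 2 2] this[of 2 3]
  show "\<Lambda> = 0"
    by (simp add: vec_eq_iff forall_3 cross3_def column_def axis_def)
qed

section \<open>Canonical angular momentum and the algebra it generates\<close>

text \<open>Coefficient vectors turn the span of the components of q x p into R^3, where the bracket
  becomes minus the cross product.\<close>

definition angular :: "real^3 \<Rightarrow> phase \<Rightarrow> real" where
  "angular c z = c \<bullet> cross3 (fst z) (snd z)"

lemma partial_angular:
  "partial_q \<nu> (angular c) z = c \<bullet> cross3 (axis \<nu> 1) (snd z)"
  "partial_p \<nu> (angular c) z = c \<bullet> cross3 (fst z) (axis \<nu> 1)"
  unfolding partial_q_def partial_p_def angular_def fst_conv snd_conv cross_add_left cross_add_right
    cross_mult_left cross_mult_right inner_add_right inner_scaleR_right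
  by (auto intro!: DERIV_imp_deriv derivative_eq_intros)

lemma nc_theta_0: "nc_theta 0 0 \<nu> = 1"
  by (simp add: nc_theta_def)

text \<open>The minus sign comes from the order of the terms in \<open>nc_bracket\<close>, opposite
  to the usual Poisson bracket.\<close>

lemma nc_bracket_angular: "nc_bracket 0 0 (angular c) (angular d) z = - angular (cross3 c d) z"
  unfolding nc_bracket_def partial_angular nc_theta_0 angular_def
  by (simp add: axis_def cross3_simps)

lemma nc_L_eq_angular: "nc_L 0 0 i = angular (axis i 1)"
  by (simp add: fun_eq_iff nc_L_def angular_def nc_q_def nc_p_def inner_axis')

text \<open>The bracket is local. This lets it respect the identification of functions that agree
  only on the open set \<open>cotangent_bundle\<close>.\<close>

lemma nc_bracket_cong:
  assumes "open S" and "z \<in> S" and "\<And>y. y \<in> S \<Longrightarrow> f y = f' y" and "\<And>y. y \<in> S \<Longrightarrow> g y = g' y"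
  shows "nc_bracket \<alpha> \<Lambda> f g z = nc_bracket \<alpha> \<Lambda> f' g' z"
proof -
  have ev: "\<forall>\<^sub>F t in nhds 0. c t \<in> S" if c: "isCont c 0" "c 0 = z" for c :: "real \<Rightarrow> phase"
  proof -
    have "(c \<longlongrightarrow> c 0) (nhds 0)"
      using c(1) by (simp only: isCont_def tendsto_at_iff_tendsto_nhds)
    then show ?thesis
      by (rule topological_tendstoD) (simp_all add: c(2) assms(1,2))
  qed
  have partial: "partial_q \<nu> h z = partial_q \<nu> h' z" "partial_p \<nu> h z = partial_p \<nu> h' z"
    if h: "\<And>y. y \<in> S \<Longrightarrow> h y = h' y" for h h' :: "phase \<Rightarrow> real" and \<nu>
  proof -
    have "\<forall>\<^sub>F t in nhds 0. (fst z + t *\<^sub>R axis \<nu> 1, snd z) \<in> S"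
      by (rule ev) (intro continuous_intros, simp)
    then show "partial_q \<nu> h z = partial_q \<nu> h' z"
      unfolding partial_q_def by (intro deriv_cong_ev refl) (erule eventually_mono, erule h)
    have "\<forall>\<^sub>F t in nhds 0. (fst z, snd z + t *\<^sub>R axis \<nu> 1) \<in> S"
      by (rule ev) (intro continuous_intros, simp)
    then show "partial_p \<nu> h z = partial_p \<nu> h' z"
      unfolding partial_p_def by (intro deriv_cong_ev refl) (erule eventually_mono, erule h)
  qed
  show ?thesis
    unfolding nc_bracket_def
    by (simp only: partial[OF assms(3)] partial[OF assms(4)])
qed

lemma open_cotangent_bundle: "open cotangent_bundle"
  unfolding cotangent_bundle_def config_space_def by (intro open_Times open_Diff) auto

lemma angular_eq_iff:
  "(\<forall>z\<in>cotangent_bundle. angular c z = angular d z) \<longleftrightarrow> c = d"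
proof
  assume *: "\<forall>z\<in>cotangent_bundle. angular c z = angular d z"
  have "angular c (axis i 1, axis j 1) = angular d (axis i 1, axis j 1)" for i j
    using * by (simp add: cotangent_bundle_def config_space_def axis_eq_0_iff)
  \<comment> \<open>The cross products of these three pairs are the basis vectors, so each
    evaluation reads off one coefficient.\<close>
  from this[of 1 2] this[of 2 3] this[of 3 1] show "c = d"
    by (simp add: angular_def cross_basis inner_axis vec_eq_iff forall_3)
qed simp

lemma lie_generated_sum:
  assumes "finite I" and "\<And>i. i \<in> I \<Longrightarrow> f i \<in> lie_generated \<alpha> \<Lambda> G"
  shows "(\<lambda>z. \<Sum>i\<in>I. c i * f i z) \<in> lie_generated \<alpha> \<Lambda> G"
  using assms
  by (induction I rule: finite_induct) (auto intro: lie_generated.zero intro!: lie_generated.add lie_generated.scale)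

lemma angular_in_lie_generated: "angular c \<in> lie_generated 0 0 (range (nc_L 0 0))"
proof -
  have "angular c = (\<lambda>z. \<Sum>i\<in>UNIV. c $ i * nc_L 0 0 i z)"
    by (simp add: fun_eq_iff nc_L_eq_angular angular_def inner_vec_def[of c] inner_axis')
  then show ?thesis
    by (simp only:) (intro lie_generated_sum lie_generated.gen, auto)
qed

lemma lie_generated_angular:
  assumes "f \<in> lie_generated 0 0 (range (nc_L 0 0))"
  shows "\<exists>c. \<forall>z\<in>cotangent_bundle. f z = angular c z"
  using assms
proof induction
  case (gen f)
  then show ?case
    by (auto simp: nc_L_eq_angular)
next
  case zero
  show ?case
    by (rule exI[of _ 0]) (simp add: angular_def)
next
  case (add f g)
  then show ?case
    by (metis angular_def inner_add_left)
next
  case (scale f c)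
  then show ?case
    by (metis angular_def inner_scaleR_left)
next
  case (bracket f g)
  then obtain c d where cd: "\<forall>z\<in>cotangent_bundle. f z = angular c z"
    "\<forall>z\<in>cotangent_bundle. g z = angular d z"
    by blast
  have "nc_bracket 0 0 f g z = angular (- cross3 c d) z" if "z \<in> cotangent_bundle" for z
  proof -
    have "nc_bracket 0 0 f g z = nc_bracket 0 0 (angular c) (angular d) z"
      using cd by (intro nc_bracket_cong[OF open_cotangent_bundle that]) auto
    then show ?thesis
      by (simp only: nc_bracket_angular) (simp add: angular_def)
  qed
  then show ?case
    by blast
qed

section \<open>so(3) as R^3 with the cross product\<close>

text \<open>The inverse of the hat map: for \<open>A\<close> in \<open>so3\<close>,
  \<open>A *v x = cross3 (axial A) x\<close>.\<close>

definition axial :: "real^3^3 \<Rightarrow> real^3" where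
  "axial A = vector [A $ 3 $ 2, A $ 1 $ 3, A $ 2 $ 1]"

lemma axial_linear: "axial (A + B) = axial A + axial B" "axial (c *\<^sub>R A) = c *\<^sub>R axial A"
  by (simp_all add: axial_def vec_eq_iff forall_3)

lemma so3_nth:
  assumes "A \<in> so3"
  shows "A $ 1 $ 1 = 0" "A $ 2 $ 2 = 0" "A $ 3 $ 3 = 0"
    "A $ 1 $ 2 = - A $ 2 $ 1" "A $ 2 $ 3 = - A $ 3 $ 2" "A $ 3 $ 1 = - A $ 1 $ 3"
  using skew_nth[of A 1 1] skew_nth[of A 2 2] skew_nth[of A 3 3] skew_nth[of A 1 2]
    skew_nth[of A 2 3] skew_nth[of A 3 1] assms
  by (simp_all add: so3_def)

lemma axial_inj: "A \<in> so3 \<Longrightarrow> B \<in> so3 \<Longrightarrow> axial A = axial B \<Longrightarrow> A = B"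
  by (simp add: vec_eq_iff forall_3 axial_def so3_nth)

lemma axial_surj: "\<exists>A\<in>so3. axial A = c"
proof
  let ?A = "vector [vector [0, - c $ 3, c $ 2], vector [c $ 3, 0, - c $ 1],
    vector [- c $ 2, c $ 1, 0]] :: real^3^3"
  show "?A \<in> so3"
    by (simp add: so3_def transpose_def vec_eq_iff forall_3)
  show "axial ?A = c"
    by (simp add: axial_def vec_eq_iff forall_3)
qed

text \<open>With matrices in \<open>so3\<close> acting as cross products, this is the Jacobi
  identity.\<close>

lemma axial_commutator:
  assumes "A \<in> so3" "B \<in> so3"
  shows "axial (commutator A B) = cross3 (axial A) (axial B)"
  using so3_nth[OF assms(1)] so3_nth[OF assms(2)]
  by (simp add: axial_def commutator_def matrix_matrix_mult_def sum_3 vec_eq_iff forall_3 cross3_def)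

lemma generates_so3_canonical: "generates_so3 0 0 (range (nc_L 0 0))"
  unfolding generates_so3_def
\<comment> \<open>The sign of the witness compensates the minus sign in
  \<open>nc_bracket_angular\<close>.\<close>
proof (intro exI[of _ "\<lambda>A. angular (- axial A)"] conjI ballI allI impI)
  fix f
  assume "f \<in> lie_generated 0 0 (range (nc_L 0 0))"
  then obtain c where "\<forall>z\<in>cotangent_bundle. f z = angular c z"
    using lie_generated_angular by blast
  moreover obtain A where "A \<in> so3" "axial A = - c"
    using axial_surj by blast
  ultimately show "\<exists>A\<in>so3. \<forall>z\<in>cotangent_bundle. f z = angular (- axial A) z"
    by force
next
  fix A B :: "real^3^3"
  assume "A \<in> so3" "B \<in> so3" "\<forall>z\<in>cotangent_bundle. angular (- axial A) z = angular (- axial B) z"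
  then show "A = B"
    by (simp add: angular_eq_iff axial_inj)
next
  fix A B :: "real^3^3" and z
  assume "A \<in> so3" "B \<in> so3"
  then show "angular (- axial (commutator A B)) z =
      nc_bracket 0 0 (angular (- axial A)) (angular (- axial B)) z"
    by (simp add: nc_bracket_angular axial_commutator) (simp add: angular_def)
qed (auto simp: angular_in_lie_generated axial_linear angular_def algebra_simps)

text \<open>Here all thetas are 1, so F'_hh = -1, which is the sign in
  \<open>nc_bracket_angular\<close>.\<close>

lemma nc_bracket_L_canonical:
  "nc_bracket 0 0 (nc_L 0 0 i) (nc_L 0 0 j) z =
    (\<Sum>h\<in>UNIV. levi_civita i j h * nc_F' 0 0 h h z * nc_L 0 0 h z)"
  using exhaust_3[of i] exhaust_3[of j]
  by (auto simp: nc_L_eq_angular nc_bracket_angular nc_F'_def nc_F_eq nc_theta_0 sum_3 cross_basis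
      levi_civita_def index_value_def) (simp_all add: angular_def)

theorem proposition2:
  fixes \<alpha> \<Lambda> :: "real^3^3" and m k :: real
  assumes "m > 0" and "k > 0"
    and "transpose \<alpha> = - \<alpha>" and "transpose \<Lambda> = - \<Lambda>"
    and "\<And>\<nu>. nc_theta \<alpha> \<Lambda> \<nu> \<noteq> 0"
    and "\<And>i z. z \<in> cotangent_bundle \<Longrightarrow> nc_Y \<alpha> z \<noteq> 0 \<Longrightarrow>
           nc_bracket \<alpha> \<Lambda> (nc_H m k \<alpha> \<Lambda>) (nc_L \<alpha> \<Lambda> i) z = 0"
  shows "generates_so3 \<alpha> \<Lambda> (range (nc_L \<alpha> \<Lambda>)) \<and>
    (\<forall>i j. \<forall>z\<in>cotangent_bundle.
       nc_bracket \<alpha> \<Lambda> (nc_L \<alpha> \<Lambda> i) (nc_L \<alpha> \<Lambda> j) z =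
         (\<Sum>h\<in>UNIV. levi_civita i j h * nc_F' \<alpha> \<Lambda> h h z * nc_L \<alpha> \<Lambda> h z))"
proof -
  note parts = parts_eq_0[OF assms(1,2,6)]
  have "\<alpha> = 0" "\<Lambda> = 0"
    using noncommutativity_eq_0[OF assms(3-5) parts] by auto
  then show ?thesis
    by (simp add: generates_so3_canonical nc_bracket_L_canonical)
qed

end
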